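(* Let $(X,d)$ be a complete metric space and let $A,B$ be non-empty closed subsets of $X$ with $|A_0|\geq 3$. Let $T:A\to B$ be a continuous perimetric proximal contraction of the first kind such that $T(A_0)\subseteq B_0$. If $T$ satisfies Condition $\Lambda$, then $T$ possesses a best proximity point. Moreover, $T$ has at most two best proximity points.
   Context: For non-empty subsets $A,B$ of a metric space $(X,d)$, put $d(A,B)=\inf\{d(a,b): a\in A,\ b\in B\}$, $A_0=\{x\in A: d(x,y)=d(A,B)\text{ for some } y\in B\}$, and $B_0=\{y\in B: d(x,y)=d(A,B)\text{ for some } x\in A\}$. A best proximity point of a mapping $T:A\to B$ is a point $x^*\in A$ such that $d(x^*,Tx^* )=d(A,B)$. A mapping $T:A\to B$ is a perimetric proximal contraction of the first kind if there exists $\alpha\in[0,1)$ such that for all $u_1,u_2,u_3,x_1,x_2,x_3\in A$ with $x_1,x_2,x_3$ pairwise distinct, the equalities $d(u_1,Tx_1)=d(u_2,Tx_2)=d(u_3,Tx_3)=d(A,B)$ imply $$d(u_1,u_2)+d(u_2,u_3)+d(u_3,u_1)\leq \alpha\{d(x_1,x_2)+d(x_2,x_3)+d(x_3,x_1)\}.$$ A mapping $T:A\to B$ satisfies Condition $\Lambda$ if there is no pair of points $x,y\in A$ with $x\neq y$ such that $d(x,Ty)=d(y,Tx)=d(A,B)$. *)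

theory Defs
  imports "HOL-Analysis.Analysis"
begin

text \<open>
  The distance \<open>d(A,B)\<close> of two non-empty sets is \<^const>\<open>setdist\<close>. A mapping \<open>T : A \<rightarrow> B\<close> is a
  total function used only on \<open>A\<close>; that it maps \<open>A\<close> into \<open>B\<close> is not part of the definitions below
  and has to be assumed separately. The sets \<open>A\<^sub>0\<close> and \<open>B\<^sub>0\<close> are \<open>proximal_left A B\<close> and
  \<open>proximal_right A B\<close>.
\<close>

definition proximal_left :: "'a::metric_space set \<Rightarrow> 'a set \<Rightarrow> 'a set" where
  "proximal_left A B = {x \<in> A. \<exists>y\<in>B. dist x y = setdist A B}"

definition proximal_right :: "'a::metric_space set \<Rightarrow> 'a set \<Rightarrow> 'a set" where
  "proximal_right A B = {y \<in> B. \<exists>x\<in>A. dist x y = setdist A B}"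

definition best_proximity_point ::
    "'a::metric_space set \<Rightarrow> 'a set \<Rightarrow> ('a \<Rightarrow> 'a) \<Rightarrow> 'a \<Rightarrow> bool" where
  "best_proximity_point A B T x \<longleftrightarrow> x \<in> A \<and> dist x (T x) = setdist A B"

definition perimetric_proximal_contraction_first ::
    "'a::metric_space set \<Rightarrow> 'a set \<Rightarrow> ('a \<Rightarrow> 'a) \<Rightarrow> bool" where
  "perimetric_proximal_contraction_first A B T \<longleftrightarrow>
    (\<exists>\<alpha>::real. 0 \<le> \<alpha> \<and> \<alpha> < 1 \<and>
      (\<forall>u1\<in>A. \<forall>u2\<in>A. \<forall>u3\<in>A. \<forall>x1\<in>A. \<forall>x2\<in>A. \<forall>x3\<in>A.
        x1 \<noteq> x2 \<and> x2 \<noteq> x3 \<and> x3 \<noteq> x1 \<and>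
        dist u1 (T x1) = setdist A B \<and>
        dist u2 (T x2) = setdist A B \<and>
        dist u3 (T x3) = setdist A B \<longrightarrow>
        dist u1 u2 + dist u2 u3 + dist u3 u1
          \<le> \<alpha> * (dist x1 x2 + dist x2 x3 + dist x3 x1)))"

definition condition_Lambda ::
    "'a::metric_space set \<Rightarrow> 'a set \<Rightarrow> ('a \<Rightarrow> 'a) \<Rightarrow> bool" where
  "condition_Lambda A B T \<longleftrightarrow>
    \<not> (\<exists>x\<in>A. \<exists>y\<in>A. x \<noteq> y \<and>
         dist x (T y) = setdist A B \<and> dist y (T x) = setdist A B)"

end

theory Submission
  imports Defs
begin

text \<open>
  Existence is a Picard iteration. Every \<open>x \<in> A\<^sub>0\<close> has a proximal image, that is a point
  \<open>f x \<in> A\<^sub>0\<close> with \<open>d(f x, T x) = d(A,B)\<close>, and a fixed point of \<open>f\<close> is a best proximity point.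
  If \<open>f\<close> has no fixed point, then Condition \<open>\<Lambda>\<close> also forbids 2-cycles of \<open>f\<close>, so
  \<open>x, f x, f (f x)\<close> are always pairwise distinct. The contraction hypothesis therefore
  applies at every step of the orbit of any point and makes the perimeters of the triangles formed
  by three consecutive points decay geometrically. A side is at most the perimeter, so the orbit is
  Cauchy (\<open>Cauchy_if_geometric_steps\<close>), and its limit is a best proximity point by continuity
  of \<open>T\<close>.

  Three distinct best proximity points would be their own proximal images, so that their
  triangle would have positive perimeter at most \<open>\<alpha> < 1\<close> times itself.
\<close>

text \<open>
  The distance from \<open>s m\<close> to any later term is at most the tail \<open>c \<alpha>\<^sup>m / (1 - \<alpha>)\<close> of the geometric
  series; keeping the factor \<open>1 - \<alpha>\<^sup>k\<close> of the partial sum makes the induction on \<open>k\<close> go through.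
\<close>

lemma Cauchy_if_geometric_steps:
  fixes s :: "nat \<Rightarrow> 'a::metric_space" and c \<alpha> :: real
  assumes step: "\<And>n. dist (s n) (s (Suc n)) \<le> c * \<alpha> ^ n"
    and \<alpha>: "0 \<le> \<alpha>" "\<alpha> < 1"
  shows "Cauchy s"
proof (rule metric_CauchyI)
  fix e :: real
  assume e: "e > 0"
  have c: "0 \<le> c"
    using order_trans[OF zero_le_dist step[of 0]] by simp
  have partial: "dist (s m) (s (m + k)) \<le> c * \<alpha> ^ m * (1 - \<alpha> ^ k) / (1 - \<alpha>)" for m k
  proof (induction k)
    case 0
    show ?case by simp
  next
    case (Suc k)
    have "dist (s m) (s (m + Suc k)) \<le> dist (s m) (s (m + k)) + dist (s (m + k)) (s (Suc (m + k)))"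
      by (simp add: dist_triangle)
    also have "\<dots> \<le> c * \<alpha> ^ m * (1 - \<alpha> ^ k) / (1 - \<alpha>) + c * \<alpha> ^ (m + k)"
      by (intro add_mono Suc.IH step)
    also have "\<dots> = c * \<alpha> ^ m * (1 - \<alpha> ^ Suc k) / (1 - \<alpha>)"
      using \<alpha> by (simp add: field_simps power_add)
    finally show ?case .
  qed
  have tail: "dist (s m) (s n) \<le> c / (1 - \<alpha>) * \<alpha> ^ m" if "m \<le> n" for m n
  proof -
    have "dist (s m) (s n) \<le> c * \<alpha> ^ m * (1 - \<alpha> ^ (n - m)) / (1 - \<alpha>)"
      using partial[of m "n - m"] that by simp
    also have "\<dots> \<le> c * \<alpha> ^ m * 1 / (1 - \<alpha>)"
      using c \<alpha> by (intro divide_right_mono mult_left_mono) auto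
    finally show ?thesis by simp
  qed
  have "(\<lambda>m. c / (1 - \<alpha>) * \<alpha> ^ m) \<longlonglongrightarrow> c / (1 - \<alpha>) * 0"
    using \<alpha> by (intro tendsto_intros LIMSEQ_power_zero) auto
  then have "\<forall>\<^sub>F m in sequentially. c / (1 - \<alpha>) * \<alpha> ^ m < e"
    using e by (intro order_tendstoD(2)) auto
  then obtain M where M: "c / (1 - \<alpha>) * \<alpha> ^ m < e" if "m \<ge> M" for m
    by (auto simp: eventually_sequentially)
  have "dist (s m) (s n) < e" if "m \<ge> M" "n \<ge> M" for m n
    using tail[of m n] tail[of n m] M[of m] M[of n] that
    by (cases m n rule: le_cases) (auto simp: dist_commute)
  then show "\<exists>M. \<forall>m\<ge>M. \<forall>n\<ge>M. dist (s m) (s n) < e" by blast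
qed

text \<open>
  The contraction property with its factor as a parameter: the orbit estimate needs one factor
  that serves for all triangles.
\<close>

definition shrinks_proximal_perimeters ::
    "real \<Rightarrow> 'a::metric_space set \<Rightarrow> 'a set \<Rightarrow> ('a \<Rightarrow> 'a) \<Rightarrow> bool" where
  "shrinks_proximal_perimeters \<alpha> A B T \<longleftrightarrow>
    (\<forall>u1\<in>A. \<forall>u2\<in>A. \<forall>u3\<in>A. \<forall>x1\<in>A. \<forall>x2\<in>A. \<forall>x3\<in>A.
      x1 \<noteq> x2 \<and> x2 \<noteq> x3 \<and> x3 \<noteq> x1 \<and>
      dist u1 (T x1) = setdist A B \<and>
      dist u2 (T x2) = setdist A B \<and>
      dist u3 (T x3) = setdist A B \<longrightarrow>
      dist u1 u2 + dist u2 u3 + dist u3 u1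
        \<le> \<alpha> * (dist x1 x2 + dist x2 x3 + dist x3 x1))"

lemma obtain_perimeter_factor:
  assumes "perimetric_proximal_contraction_first A B T"
  obtains \<alpha> where "0 \<le> \<alpha>" "\<alpha> < 1" "shrinks_proximal_perimeters \<alpha> A B T"
proof -
  have "\<exists>\<alpha>. 0 \<le> \<alpha> \<and> \<alpha> < 1 \<and> shrinks_proximal_perimeters \<alpha> A B T"
    using assms
    unfolding perimetric_proximal_contraction_first_def shrinks_proximal_perimeters_def .
  then show thesis
    using that by blast
qed

lemma shrinks_proximal_perimetersD:
  assumes "shrinks_proximal_perimeters \<alpha> A B T"
    and "u1 \<in> A" "u2 \<in> A" "u3 \<in> A" "x1 \<in> A" "x2 \<in> A" "x3 \<in> A"
    and "x1 \<noteq> x2" "x2 \<noteq> x3" "x3 \<noteq> x1"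
    and "dist u1 (T x1) = setdist A B" "dist u2 (T x2) = setdist A B"
      "dist u3 (T x3) = setdist A B"
  shows "dist u1 u2 + dist u2 u3 + dist u3 u1 \<le> \<alpha> * (dist x1 x2 + dist x2 x3 + dist x3 x1)"
  using assms(1)[unfolded shrinks_proximal_perimeters_def, rule_format, of u1 u2 u3 x1 x2 x3]
    assms(2-) by simp

text \<open>
  The selection stays in \<open>A\<^sub>0\<close> because \<open>T x \<in> B\<close> is itself the witness that a point at distance
  \<open>d(A,B)\<close> from \<open>T x\<close> is proximal, so it can be iterated.
\<close>

lemma obtain_proximal_selection:
  assumes "T ` proximal_left A B \<subseteq> proximal_right A B"
  obtains f where "\<And>x. x \<in> proximal_left A B \<Longrightarrow> f x \<in> proximal_left A B"
    and "\<And>x. x \<in> proximal_left A B \<Longrightarrow> dist (f x) (T x) = setdist A B"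
proof -
  have "\<exists>u. u \<in> proximal_left A B \<and> dist u (T x) = setdist A B"
    if "x \<in> proximal_left A B" for x
  proof -
    have "T x \<in> proximal_right A B"
      using assms that by blast
    then obtain u where "u \<in> A" "T x \<in> B" "dist u (T x) = setdist A B"
      unfolding proximal_right_def by blast
    then show ?thesis
      unfolding proximal_left_def by blast
  qed
  then obtain f where "\<And>x. x \<in> proximal_left A B
      \<Longrightarrow> f x \<in> proximal_left A B \<and> dist (f x) (T x) = setdist A B"
    by metis
  then show thesis
    using that by blast
qed

text \<open>
  Both \<open>s (Suc n)\<close> and \<open>T (s n)\<close> converge, to \<open>l\<close> and \<open>T l\<close>, while their distance is constant.
\<close>

lemma best_proximity_point_limit:
  assumes "closed A" and "continuous_on A T"
    and s: "\<And>n. s n \<in> A" "\<And>n. dist (s (Suc n)) (T (s n)) = setdist A B"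
    and lim: "s \<longlonglongrightarrow> l"
  shows "best_proximity_point A B T l"
proof -
  have l: "l \<in> A"
    using closed_sequentially[OF \<open>closed A\<close> _ lim] s(1) by blast
  have "(\<lambda>n. T (s n)) \<longlonglongrightarrow> T l"
    using continuous_on_tendsto_compose[OF \<open>continuous_on A T\<close> lim l] s(1) by simp
  then have "(\<lambda>n. dist (s (Suc n)) (T (s n))) \<longlonglongrightarrow> dist l (T l)"
    using LIMSEQ_Suc[OF lim] by (intro tendsto_dist)
  then have "dist l (T l) = setdist A B"
    by (simp add: s(2) LIMSEQ_const_iff)
  with l show ?thesis
    by (simp add: best_proximity_point_def)
qed

text \<open>
  The contraction hypothesis concerns triples of distinct points only. An orbit of a selection
  supplies such triples at every step unless it meets a fixed point, which is already a best
  proximity point, or a 2-cycle, which is a pair of points excluded by Condition \<open>\<Lambda>\<close>.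
\<close>

lemma best_proximity_point_exists:
  fixes A B :: "'a::complete_space set"
  assumes "closed A" and "proximal_left A B \<noteq> {}" and "continuous_on A T"
    and contr: "perimetric_proximal_contraction_first A B T"
    and "T ` proximal_left A B \<subseteq> proximal_right A B"
    and Lambda: "condition_Lambda A B T"
  shows "\<exists>x. best_proximity_point A B T x"
proof -
  obtain f where f: "\<And>x. x \<in> proximal_left A B \<Longrightarrow> f x \<in> proximal_left A B"
    and fT: "\<And>x. x \<in> proximal_left A B \<Longrightarrow> dist (f x) (T x) = setdist A B"
    using obtain_proximal_selection assms by metis
  have left_A: "x \<in> A" if "x \<in> proximal_left A B" for x
    using that by (simp add: proximal_left_def)
  show ?thesis
  proof (cases "\<exists>x\<in>proximal_left A B. f x = x")
    case True
    then show ?thesis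
      using fT left_A by (metis best_proximity_point_def)
  next
    case False
    then have no_fix: "f x \<noteq> x" if "x \<in> proximal_left A B" for x
      using that by blast
    have no_cycle: "f (f x) \<noteq> x" if x: "x \<in> proximal_left A B" for x
      using Lambda fT[OF x] fT[OF f[OF x]] no_fix[OF x] left_A[OF x] left_A[OF f[OF x]]
      unfolding condition_Lambda_def by metis
    obtain \<alpha> where \<alpha>: "0 \<le> \<alpha>" "\<alpha> < 1" and shrink: "shrinks_proximal_perimeters \<alpha> A B T"
      using obtain_perimeter_factor[OF contr] by blast
    obtain x0 where x0: "x0 \<in> proximal_left A B"
      using assms by blast
    define s where "s n = (f ^^ n) x0" for n
    have s_Suc: "s (Suc n) = f (s n)" for n
      by (simp add: s_def)
    have s_left: "s n \<in> proximal_left A B" for n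
      by (induction n) (auto simp: s_def x0 f)
    define p where
      "p n = dist (s n) (s (Suc n)) + dist (s (Suc n)) (s (Suc (Suc n)))
        + dist (s (Suc (Suc n))) (s n)" for n
    have p_Suc: "p (Suc n) \<le> \<alpha> * p n" for n
      unfolding p_def
    proof (rule shrinks_proximal_perimetersD[OF shrink])
      show "s n \<noteq> s (Suc n)" "s (Suc n) \<noteq> s (Suc (Suc n))" "s (Suc (Suc n)) \<noteq> s n"
        using no_fix[OF s_left[of n]] no_fix[OF s_left[of "Suc n"]] no_cycle[OF s_left[of n]]
        by (auto simp: s_Suc)
    qed (use s_left left_A fT in \<open>auto simp: s_Suc f\<close>)
    have p_geometric: "p n \<le> p 0 * \<alpha> ^ n" for n
    proof (induction n)
      case (Suc n)
      have "p (Suc n) \<le> \<alpha> * p n" by (rule p_Suc)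
      also have "\<dots> \<le> \<alpha> * (p 0 * \<alpha> ^ n)"
        using Suc.IH \<alpha>(1) by (rule mult_left_mono)
      finally show ?case by (simp add: mult_ac)
    qed simp
    have "dist (s n) (s (Suc n)) \<le> p 0 * \<alpha> ^ n" for n
    proof -
      have "dist (s n) (s (Suc n)) \<le> p n" by (simp add: p_def)
      then show ?thesis using p_geometric by (rule order_trans)
    qed
    then have "Cauchy s"
      using \<alpha> by (rule Cauchy_if_geometric_steps)
    then obtain l where "s \<longlonglongrightarrow> l"
      using Cauchy_convergent convergentD by blast
    then have "best_proximity_point A B T l"
      using assms s_left left_A fT by (intro best_proximity_point_limit) (auto simp: s_Suc)
    then show ?thesis ..
  qed
qed

text \<open>
  A best proximity point is its own proximal image, so the contraction inequality compares the
  triangle \<open>x, y, z\<close> with itself.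
\<close>

lemma best_proximity_points_not_three:
  assumes "perimetric_proximal_contraction_first A B T"
    and "best_proximity_point A B T x" "best_proximity_point A B T y" "best_proximity_point A B T z"
    and distinct: "x \<noteq> y" "y \<noteq> z" "z \<noteq> x"
  shows False
proof -
  define p where "p = dist x y + dist y z + dist z x"
  obtain \<alpha> where "\<alpha> < 1" and shrink: "shrinks_proximal_perimeters \<alpha> A B T"
    using obtain_perimeter_factor[OF assms(1)] by blast
  have "p \<le> \<alpha> * p"
    unfolding p_def using assms by (intro shrinks_proximal_perimetersD[OF shrink]) (auto simp: best_proximity_point_def)
  with \<open>\<alpha> < 1\<close> have "p \<le> 0"
    by (auto simp: mult_le_cancel_right1)
  moreover have "p > 0"
    using distinct by (simp add: p_def add_pos_pos)
  ultimately show False by simp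
qed

theorem theorem2p4:
  fixes A B :: "'a::complete_space set" and T :: "'a \<Rightarrow> 'a"
  assumes "A \<noteq> {}" and "B \<noteq> {}"
    and "closed A" and "closed B"
    and "infinite (proximal_left A B) \<or> card (proximal_left A B) \<ge> 3"
    and "T ` A \<subseteq> B"
    and "continuous_on A T"
    and "perimetric_proximal_contraction_first A B T"
    and "T ` proximal_left A B \<subseteq> proximal_right A B"
    and "condition_Lambda A B T"
  shows "(\<exists>x. best_proximity_point A B T x) \<and>
    finite {x. best_proximity_point A B T x} \<and>
    card {x. best_proximity_point A B T x} \<le> 2"
proof -
  let ?S = "{x. best_proximity_point A B T x}"
  have "proximal_left A B \<noteq> {}"
    using assms(5) by auto
  then have "\<exists>x. best_proximity_point A B T x"
    using assms by (intro best_proximity_point_exists)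
  moreover have "finite ?S \<and> card ?S \<le> 2"
  proof (rule ccontr)
    assume "\<not> (finite ?S \<and> card ?S \<le> 2)"
    then have "infinite ?S \<or> 3 \<le> card ?S"
      by auto
    then obtain S where "S \<subseteq> ?S" "card S = 3"
      by (metis infinite_arbitrarily_large obtain_subset_with_card_n)
    then obtain x y z where "{x, y, z} \<subseteq> ?S" "x \<noteq> y" "y \<noteq> z" "z \<noteq> x"
      by (auto simp: card_3_iff)
    then show False
      using best_proximity_points_not_three[OF assms(8), of x y z] by auto
  qed
  ultimately show ?thesis by blast
qed

end
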